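(* Let $G$ be a group and $H$ a hyperbolically embedded subgroup of $G$. Then $H$ is almost malnormal in $G$, i.e., $|H\cap H^g|<\infty$ for every $g\in G$ with $g\notin H$.
   Context: Notation: $H^g=g^{-1}Hg$. Hyperbolic embedding. Let $H\le G$ and $X\subseteq G$ with $G=\langle X\cup H\rangle$. $\Gamma(G,X\sqcup H)$ is the Cayley graph of $G$ with respect to the alphabet $X\sqcup H$, where $X$ and $H$ are regarded as disjoint alphabets (an element represented both by a letter of $X$ and a letter of $H$ gives two differently labelled edges). Let $\Gamma_H$ be the Cayley graph of $H$ with respect to the generating set $H$, viewed as a complete subgraph of $\Gamma(G,X\sqcup H)$. A path is admissible if it contains no edges of $\Gamma_H$ (it may pass through vertices of $\Gamma_H$). For $h_1,h_2\in H$ let $\widehat{d}(h_1,h_2)\in[0,\infty]$ be the length of a shortest admissible path from $h_1$ to $h_2$ ($\infty$ if none). One writes $H\hookrightarrow_h(G,X)$ if (i) $G=\langle X\cup H\rangle$; (ii) $\Gamma(G,X\sqcup H)$ is Gromov hyperbolic; (iii) every ball of finite radius in $(H,\widehat{d})$ is finite. $H$ is hyperbolically embedded in $G$ if $H\hookrightarrow_h(G,X)$ for some $X\subseteq G$. *)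

theory Defs
  imports
    "HOL-Algebra.Generated_Groups"
    "HOL-Library.Extended_Nat"
    "Graph_Theory.Arc_Walk"
begin

text \<open>
  The Cayley graph of \<open>G\<close> over an alphabet \<open>A\<close> of abstract letters, where the letter \<open>a\<close>
  represents the element \<open>\<epsilon> a\<close>.  The geometric edge labelled \<open>a\<close> that joins \<open>v\<close> to
  \<open>v \<otimes> \<epsilon> a\<close> can be traversed in both directions: the arc \<open>(v, a, True)\<close> runs from
  \<open>v\<close> to \<open>v \<otimes> \<epsilon> a\<close>, and \<open>(v, a, False)\<close> is the same edge run backwards.
\<close>

definition cayley_graph ::
  "('g, 'm) monoid_scheme \<Rightarrow> 'l set \<Rightarrow> ('l \<Rightarrow> 'g) \<Rightarrow> ('g, 'g \<times> 'l \<times> bool) pre_digraph" where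
  "cayley_graph G A \<epsilon> =
     \<lparr>verts = carrier G,
      arcs = carrier G \<times> A \<times> UNIV,
      tail = (\<lambda>(v, a, fwd). if fwd then v else v \<otimes>\<^bsub>G\<^esub> \<epsilon> a),
      head = (\<lambda>(v, a, fwd). if fwd then v \<otimes>\<^bsub>G\<^esub> \<epsilon> a else v)\<rparr>"

definition graph_dist :: "('v, 'e) pre_digraph \<Rightarrow> 'v \<Rightarrow> 'v \<Rightarrow> enat" where
  "graph_dist \<Gamma> u v = (INF p \<in> {p. pre_digraph.awalk \<Gamma> u p v}. enat (length p))"

definition gromov_product :: "('v \<Rightarrow> 'v \<Rightarrow> real) \<Rightarrow> 'v \<Rightarrow> 'v \<Rightarrow> 'v \<Rightarrow> real" where
  "gromov_product d w x y = (d x w + d y w - d x y) / 2"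

definition gromov_hyperbolic :: "'v set \<Rightarrow> ('v \<Rightarrow> 'v \<Rightarrow> real) \<Rightarrow> bool" where
  "gromov_hyperbolic M d \<longleftrightarrow>
     (\<exists>\<delta>\<ge>0. \<forall>w\<in>M. \<forall>x\<in>M. \<forall>y\<in>M. \<forall>z\<in>M.
        gromov_product d w x z \<ge> min (gromov_product d w x y) (gromov_product d w y z) - \<delta>)"

text \<open>
  A graph is regarded as the metric space formed by its vertices with the edge-path distance.
  Connectedness is required, so the conversion to real distances never meets \<open>\<infinity>\<close>.
\<close>

definition hyperbolic_graph :: "('v, 'e) pre_digraph \<Rightarrow> bool" where
  "hyperbolic_graph \<Gamma> \<longleftrightarrow>
     (\<forall>u\<in>verts \<Gamma>. \<forall>v\<in>verts \<Gamma>. graph_dist \<Gamma> u v \<noteq> \<infinity>) \<and>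
     gromov_hyperbolic (verts \<Gamma>) (\<lambda>u v. real (the_enat (graph_dist \<Gamma> u v)))"

text \<open>
  The disjoint alphabet \<open>X \<squnion> H\<close> is the disjoint sum \<open>X <+> H\<close>: \<open>Inl x\<close> is the letter
  \<open>x \<in> X\<close>, and \<open>Inr h\<close> is the letter \<open>h \<in> H\<close>.
\<close>

definition rel_cayley_graph ::
  "('g, 'm) monoid_scheme \<Rightarrow> 'g set \<Rightarrow> 'g set \<Rightarrow> ('g, 'g \<times> ('g + 'g) \<times> bool) pre_digraph" where
  "rel_cayley_graph G X H = cayley_graph G (X <+> H) (case_sum id id)"

text \<open>
  The subgraph \<open>\<Gamma>\<^sub>H\<close>: only edges based at a vertex of \<open>H\<close> and labelled by a letter
  of \<open>H\<close>.  Edges between vertices of \<open>H\<close> labelled by letters of \<open>X\<close> are not in it.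
\<close>

definition sub_cayley_graph ::
  "('g, 'm) monoid_scheme \<Rightarrow> 'g set \<Rightarrow> ('g, 'g \<times> ('g + 'g) \<times> bool) pre_digraph" where
  "sub_cayley_graph G H = cayley_graph (G\<lparr>carrier := H\<rparr>) (Inr ` H) (case_sum id id)"

definition admissible_path ::
  "('g, 'm) monoid_scheme \<Rightarrow> 'g set \<Rightarrow> 'g set \<Rightarrow> 'g \<Rightarrow> ('g \<times> ('g + 'g) \<times> bool) list \<Rightarrow> 'g \<Rightarrow> bool"
where
  "admissible_path G X H u p v \<longleftrightarrow>
     pre_digraph.awalk (rel_cayley_graph G X H) u p v \<and>
     set p \<inter> arcs (sub_cayley_graph G H) = {}"

definition hat_dist ::
  "('g, 'm) monoid_scheme \<Rightarrow> 'g set \<Rightarrow> 'g set \<Rightarrow> 'g \<Rightarrow> 'g \<Rightarrow> enat" where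
  "hat_dist G X H h k = (INF p \<in> {p. admissible_path G X H h p k}. enat (length p))"

definition hyp_embedded_wrt ::
  "('g, 'm) monoid_scheme \<Rightarrow> 'g set \<Rightarrow> 'g set \<Rightarrow> bool" where
  "hyp_embedded_wrt G X H \<longleftrightarrow>
     generate G (X \<union> H) = carrier G \<and>
     hyperbolic_graph (rel_cayley_graph G X H) \<and>
     (\<forall>h\<in>H. \<forall>n::nat. finite {k \<in> H. hat_dist G X H h k \<le> enat n})"

definition hyperbolically_embedded :: "('g, 'm) monoid_scheme \<Rightarrow> 'g set \<Rightarrow> bool" where
  "hyperbolically_embedded G H \<longleftrightarrow>
     subgroup H G \<and> (\<exists>X. X \<subseteq> carrier G \<and> hyp_embedded_wrt G X H)"

definition conj_subgroup :: "('g, 'm) monoid_scheme \<Rightarrow> 'g set \<Rightarrow> 'g \<Rightarrow> 'g set" where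
  "conj_subgroup G H g = {inv\<^bsub>G\<^esub> g \<otimes>\<^bsub>G\<^esub> h \<otimes>\<^bsub>G\<^esub> g | h. h \<in> H}"

definition almost_malnormal :: "('g, 'm) monoid_scheme \<Rightarrow> 'g set \<Rightarrow> bool" where
  "almost_malnormal G H \<longleftrightarrow>
     (\<forall>g \<in> carrier G. g \<notin> H \<longrightarrow> finite (H \<inter> conj_subgroup G H g))"

end

theory Submission
  imports Defs
begin

text \<open>
  Cutting a path from \<open>1\<close> to \<open>g\<close> after its last edge in \<open>\<Gamma>\<^sub>H\<close> gives an admissible
  path \<open>p\<close> from some \<open>u \<in> H\<close> to \<open>g\<close>.  If \<open>k \<in> H \<inter> H\<^sup>g\<close>, say \<open>g k = h g\<close> with
  \<open>h \<in> H\<close>, then \<open>p\<close>, the edge from \<open>g\<close> to \<open>g k\<close> (which is outside \<open>\<Gamma>\<^sub>H\<close> because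
  \<open>g \<notin> H\<close>), and the reverse of the translate \<open>h p\<close> form an admissible path from \<open>u\<close> to
  \<open>h u\<close> of length \<open>2 |p| + 1\<close>.  This bound does not depend on \<open>k\<close>, so there are finitely
  many such \<open>h\<close>.
\<close>

text \<open>An infimum over no walks at all is \<open>\<infinity>\<close>, so a finite distance
  forces a walk to exist.\<close>

lemma awalk_if_graph_dist_finite:
  assumes "graph_dist \<Gamma> u v \<noteq> \<infinity>"
  obtains p where "pre_digraph.awalk \<Gamma> u p v"
proof -
  have "{p. pre_digraph.awalk \<Gamma> u p v} \<noteq> {}"
  proof
    assume "{p. pre_digraph.awalk \<Gamma> u p v} = {}"
    then have "graph_dist \<Gamma> u v = \<infinity>"
      by (simp add: graph_dist_def top_enat_def)
    with assms show False by simp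
  qed
  with that show thesis by blast
qed

locale rel_cayley = group G for G :: "('g, 'm) monoid_scheme" (structure) +
  fixes X H :: "'g set"
  assumes X_carrier: "X \<subseteq> carrier G" and H_subgroup: "subgroup H G"
begin

abbreviation \<Gamma> where "\<Gamma> \<equiv> rel_cayley_graph G X H"

abbreviation adm where "adm \<equiv> admissible_path G X H"

lemma letter_carrier: "a \<in> X <+> H \<Longrightarrow> case_sum id id a \<in> carrier G"
  using X_carrier subgroup.subset[OF H_subgroup] by auto

sublocale wf_digraph \<Gamma>
  by standard
    (auto simp: rel_cayley_graph_def cayley_graph_def subsetD[OF X_carrier]
      subgroup.mem_carrier[OF H_subgroup])

lemma arcs_H: "arcs (sub_cayley_graph G H) = H \<times> Inr ` H \<times> UNIV"
  by (simp add: sub_cayley_graph_def cayley_graph_def)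

lemma verts_\<Gamma>: "verts \<Gamma> = carrier G"
  by (simp add: rel_cayley_graph_def cayley_graph_def)

lemma head_in_H:
  "e \<in> arcs (sub_cayley_graph G H) \<Longrightarrow> head \<Gamma> e \<in> H"
  by (auto simp: arcs_H rel_cayley_graph_def cayley_graph_def subgroup.m_closed[OF H_subgroup])

lemma adm_Nil: "u \<in> carrier G \<Longrightarrow> adm u [] u"
  by (simp add: admissible_path_def awalk_Nil_iff verts_\<Gamma>)

lemma adm_append: "adm u p v \<Longrightarrow> adm v q w \<Longrightarrow> adm u (p @ q) w"
  by (auto simp: admissible_path_def intro: awalk_appendI)

lemma adm_arc:
  assumes "e \<in> arcs \<Gamma>" "e \<notin> arcs (sub_cayley_graph G H)"
  shows "adm (tail \<Gamma> e) [e] (head \<Gamma> e)"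
  using assms by (simp add: admissible_path_def arc_implies_awalk)

lemma adm_Cons:
  "adm u (e # p) w \<longleftrightarrow>
     e \<in> arcs \<Gamma> \<and> e \<notin> arcs (sub_cayley_graph G H) \<and> u = tail \<Gamma> e \<and> adm (head \<Gamma> e) p w"
  by (auto simp: admissible_path_def awalk_Cons_iff)

text \<open>Backtracking keeps the base vertex and the letter of an edge and changes only the
  direction flag; no inverse letter is involved. Since the arcs of \<Gamma>\<open>\<^sub>H\<close>
  are determined by base and letter, in both directions, admissibility survives reversal.\<close>

definition flip :: "'g \<times> ('g + 'g) \<times> bool \<Rightarrow> 'g \<times> ('g + 'g) \<times> bool" where
  "flip = (\<lambda>(v, a, b). (v, a, \<not> b))"

lemma adm_reverse: "adm u p v \<Longrightarrow> adm v (map flip (rev p)) u"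
proof (induction p arbitrary: u)
  case Nil
  then show ?case by (auto simp: admissible_path_def awalk_Nil_iff)
next
  case (Cons e p)
  have e: "e \<in> arcs \<Gamma>" "e \<notin> arcs (sub_cayley_graph G H)" "u = tail \<Gamma> e"
    and p: "adm (head \<Gamma> e) p v"
    using Cons.prems by (auto simp: adm_Cons)
  have "flip e \<in> arcs \<Gamma>" "flip e \<notin> arcs (sub_cayley_graph G H)"
    using e(1,2) by (cases e; force simp: flip_def arcs_H rel_cayley_graph_def cayley_graph_def)+
  moreover have "tail \<Gamma> (flip e) = head \<Gamma> e" "head \<Gamma> (flip e) = tail \<Gamma> e"
    by (cases e; simp add: flip_def rel_cayley_graph_def cayley_graph_def)+
  ultimately have "adm (head \<Gamma> e) [flip e] u"
    using adm_arc[of "flip e"] e by simp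
  with Cons.IH[OF p] show ?case
    by (simp add: adm_append)
qed

definition translate :: "'g \<Rightarrow> 'g \<times> ('g + 'g) \<times> bool \<Rightarrow> 'g \<times> ('g + 'g) \<times> bool" where
  "translate h = (\<lambda>(v, a, b). (h \<otimes> v, a, b))"

text \<open>Left multiplication is an automorphism of the Cayley graph that preserves labels. For
  \<open>h \<in> H\<close> it also permutes \<open>H\<close>, hence maps edges outside
  \<Gamma>\<open>\<^sub>H\<close> to edges outside it.\<close>

lemma adm_translate:
  assumes h: "h \<in> H"
  shows "adm u p v \<Longrightarrow> adm (h \<otimes> u) (map (translate h) p) (h \<otimes> v)"
proof (induction p arbitrary: u)
  case Nil
  then show ?case
    using subgroup.mem_carrier[OF H_subgroup h]
    by (auto simp: admissible_path_def awalk_Nil_iff verts_\<Gamma>)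
next
  case (Cons e p)
  obtain w a b where e_eq: "e = (w, a, b)" by (cases e)
  have h': "h \<in> carrier G" using subgroup.mem_carrier[OF H_subgroup h] .
  have e: "e \<in> arcs \<Gamma>" "e \<notin> arcs (sub_cayley_graph G H)" "u = tail \<Gamma> e"
    and p: "adm (head \<Gamma> e) p v"
    using Cons.prems by (auto simp: adm_Cons)
  have w: "w \<in> carrier G" and a: "a \<in> X <+> H"
    using e(1) by (auto simp: e_eq rel_cayley_graph_def cayley_graph_def)
  \<comment> \<open>The letter \<open>a\<close> is unchanged, so only the base vertex can affect
    membership in \<Gamma>\<open>\<^sub>H\<close>.\<close>
  have "h \<otimes> w \<in> H \<longleftrightarrow> w \<in> H"
  proof
    assume "h \<otimes> w \<in> H"
    then have "inv h \<otimes> (h \<otimes> w) \<in> H"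
      using H_subgroup h by (simp add: subgroup.m_closed subgroup.m_inv_closed)
    then show "w \<in> H" using h' w by (simp add: m_assoc[symmetric])
  qed (simp add: subgroup.m_closed[OF H_subgroup h])
  then have "translate h e \<notin> arcs (sub_cayley_graph G H)"
    using e(2) by (auto simp: e_eq translate_def arcs_H)
  moreover have "translate h e \<in> arcs \<Gamma>"
    using h' w a by (simp add: e_eq translate_def rel_cayley_graph_def cayley_graph_def)
  moreover have "tail \<Gamma> (translate h e) = h \<otimes> tail \<Gamma> e" "head \<Gamma> (translate h e) = h \<otimes> head \<Gamma> e"
    using h' w letter_carrier[OF a]
    by (auto simp: e_eq translate_def rel_cayley_graph_def cayley_graph_def m_assoc)
  ultimately show ?case
    using Cons.IH[OF p] e(3) by (simp add: adm_Cons)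
qed

text \<open>Only the part of the walk after its last edge in \<Gamma>\<open>\<^sub>H\<close> is
  kept; it starts at the head of that edge, which lies in \<open>H\<close>. Induction from the right
  meets this edge first.\<close>

lemma adm_from_H:
  assumes "awalk u p v" "u \<in> H"
  shows "\<exists>u'\<in>H. \<exists>q. adm u' q v"
  using assms
proof (induction p arbitrary: v rule: rev_induct)
  case Nil
  then show ?case using adm_Nil by (auto simp: awalk_Nil_iff verts_\<Gamma>)
next
  case (snoc e p)
  have p: "awalk u p (tail \<Gamma> e)" and e: "e \<in> arcs \<Gamma>" "head \<Gamma> e = v"
    using snoc.prems(1) by (auto simp: awalk_Cons_iff awalk_Nil_iff)
  \<comment> \<open>If the final edge is in \<Gamma>\<open>\<^sub>H\<close>, the empty path at its
    head suffices; otherwise the edge extends the path given by induction.\<close>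
  show ?case
  proof (cases "e \<in> arcs (sub_cayley_graph G H)")
    case True
    then show ?thesis
      using head_in_H[OF True] e adm_Nil subgroup.mem_carrier[OF H_subgroup] by blast
  next
    case False
    then show ?thesis
      using snoc.IH[OF p snoc.prems(2)] adm_arc[OF e(1) False] e(2) adm_append by blast
  qed
qed

lemma finite_inter_conj:
  assumes conn: "graph_dist \<Gamma> \<one> g \<noteq> \<infinity>"
    and locally_finite: "\<And>u n. u \<in> H \<Longrightarrow> finite {k \<in> H. hat_dist G X H u k \<le> enat n}"
    and g: "g \<in> carrier G" "g \<notin> H"
  shows "finite (H \<inter> conj_subgroup G H g)"
proof -
  obtain p where "awalk \<one> p g"
    using awalk_if_graph_dist_finite[OF conn] .
  then obtain u q where u: "u \<in> H" and q: "adm u q g"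
    using adm_from_H subgroup.one_closed[OF H_subgroup] by blast
  have u': "u \<in> carrier G" using subgroup.mem_carrier[OF H_subgroup u] .
  define B where "B = {k \<in> H. hat_dist G X H u k \<le> enat (2 * length q + 1)}"
  \<comment> \<open>The map recovers \<open>k\<close> from the endpoint
    \<open>h \<otimes> u\<close>: cancelling \<open>u\<close> gives \<open>h\<close>, and
    conjugating by \<open>g\<close> gives \<open>k\<close>.\<close>
  have "H \<inter> conj_subgroup G H g \<subseteq> (\<lambda>x. inv g \<otimes> (x \<otimes> inv u) \<otimes> g) ` B"
  proof
    fix k assume "k \<in> H \<inter> conj_subgroup G H g"
    then obtain h where k: "k \<in> H" "k = inv g \<otimes> h \<otimes> g" and h: "h \<in> H"
      by (auto simp: conj_subgroup_def)
    have h': "h \<in> carrier G" using subgroup.mem_carrier[OF H_subgroup h] .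
    have gk: "g \<otimes> k = h \<otimes> g"
      using g(1) h' by (simp add: k(2) m_assoc[symmetric])
    \<comment> \<open>The letter is taken from the copy \<open>Inr\<close> of \<open>H\<close>, as
      \<open>k\<close> need not be in \<open>X\<close>; the base \<open>g \<notin> H\<close> alone
      keeps this edge out of \<Gamma>\<open>\<^sub>H\<close>.\<close>
    define e :: "'g \<times> ('g + 'g) \<times> bool" where "e = (g, Inr k, True)"
    have "e \<in> arcs \<Gamma>" "e \<notin> arcs (sub_cayley_graph G H)" "tail \<Gamma> e = g" "head \<Gamma> e = h \<otimes> g"
      using g k(1) gk by (auto simp: e_def arcs_H rel_cayley_graph_def cayley_graph_def)
    then have "adm g [e] (h \<otimes> g)"
      using adm_arc[of e] by simp
    \<comment> \<open>The translate of \<open>q\<close> runs from \<open>h \<otimes> u\<close> to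
      \<open>h \<otimes> g\<close>, so its reverse starts where \<open>e\<close> ends.\<close>
    then have "adm u (q @ [e] @ map flip (rev (map (translate h) q))) (h \<otimes> u)"
      using adm_append q adm_reverse[OF adm_translate[OF h q]] by blast
    then have "hat_dist G X H u (h \<otimes> u)
        \<le> enat (length (q @ [e] @ map flip (rev (map (translate h) q))))"
      unfolding hat_dist_def by (intro INF_lower) simp
    then have "h \<otimes> u \<in> B"
      using subgroup.m_closed[OF H_subgroup h u] by (simp add: B_def mult_2)
    moreover have "k = inv g \<otimes> (h \<otimes> u \<otimes> inv u) \<otimes> g"
      using u' h' by (simp add: k(2) m_assoc)
    ultimately show "k \<in> (\<lambda>x. inv g \<otimes> (x \<otimes> inv u) \<otimes> g) ` B" by blast
  qed
  moreover have "finite B" using locally_finite[OF u] by (simp add: B_def)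
  ultimately show ?thesis using finite_surj by blast
qed

end

theorem proposition2p10:
  fixes G :: "('g, 'm) monoid_scheme" and H :: "'g set"
  assumes "group G"
    and "hyperbolically_embedded G H"
  shows "almost_malnormal G H"
proof -
  obtain X where H: "subgroup H G" and X: "X \<subseteq> carrier G" and emb: "hyp_embedded_wrt G X H"
    using assms(2) by (auto simp: hyperbolically_embedded_def)
  interpret rel_cayley G X H
    using assms(1) X H by (simp add: rel_cayley_def rel_cayley_axioms_def)
  \<comment> \<open>Connectedness is built into \<open>hyperbolic_graph\<close>.\<close>
  have "graph_dist \<Gamma> \<one>\<^bsub>G\<^esub> g \<noteq> \<infinity>" if "g \<in> carrier G" for g
    using emb that by (simp add: hyp_embedded_wrt_def hyperbolic_graph_def verts_\<Gamma>)
  then show ?thesis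
    using finite_inter_conj emb by (simp add: almost_malnormal_def hyp_embedded_wrt_def)
qed

end
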